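(* Let $b$ be a connected locally finite weighted graph over an at most countable set $V$ with values in an ordered field $\mathbb K$, let $U\subseteq V$ and let $\pi=\pi_U^b$ be the associated real transition matrix. Recurrence and transience of vertices of $U$ are understood with respect to $U$, i.e. with respect to $\pi$, and components are strongly connected components with respect to $U$. (a) If a vertex is recurrent, then it is in an essential component. Furthermore, if an essential component is finite, then every vertex contained in it is recurrent. (b) If a vertex is not in an essential component, then it is transient.
   Context: Let $(\mathbb K,\succ)$ be an ordered field and $\mathbb K^+=\{k\in\mathbb K: k\succ 0\}$; $\mathbb Q\subseteq\mathbb K$, and $\mathbb Q^+$ are the positive rationals. For $k_1,k_2\in\mathbb K^+$ write $k_1\simeq k_2$ if $c_1\prec k_1/k_2\prec c_2$ for some $c_1,c_2\in\mathbb Q^+$. Weighted graph: a symmetric map $b:V\times V\to\mathbb K^+\cup\{0\}$ with $b(x,x)=0$ for all $x$; $x\sim y$ means $b(x,y)\succ 0$. A path from $x$ to $y$ is a finite sequence $x=x_0\sim x_1\sim\dots\sim x_n=y$ ($n=0$ allowed if $x=y$); it is a path in $U$ if all $x_0,\dots,x_n$ belong to $U$. Connected: any two vertices are joined by a path. Locally finite: every vertex has finitely many neighbors. Put $b(x)=\sum_{y\in V}b(x,y)$ and $p(x,y)=b(x,y)/b(x)$ ($b(x)\succ0$ is automatic when $V$ has at least two elements). Real part: for $k\in\mathbb K$ with $|k|\prec c$ for some $c\in\mathbb Q^+$, $\rho(k)$ is the unique real number such that $|k-\rho(k)|$ is smaller than every positive rational in an ordered field containing $\mathbb K$ and $\mathbb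 R$. Real transition matrix: $\pi_U^b(x,y)=\rho(p(x,y))$ if $x\in U$; $\pi_U^b(x,x)=1$ if $x\in V\setminus U$; $\pi_U^b(x,y)=0$ if $x\in V\setminus U$, $x\ne y$. A vertex $x\in U$ is recurrent with respect to $U$ if the Markov chain $(X_n)$ with transition matrix $\pi_U^b$ started at $x$ satisfies $\mathbb P[X_n=x\text{ for infinitely many }n]=1$, and transient otherwise. A strongly connected component with respect to $U$ is a maximal (with respect to inclusion) subset $C\subseteq U$ such that for any $x,y\in C$ there is a path $x=x_0\sim\dots\sim x_n=y$ in $U$ with $b(x)\simeq b(x_i,x_{i+1})\simeq b(y)$ for all $i=0,\dots,n-1$. A strongly connected component $C$ with respect to $U$ is called essential (or absorbing) if for every $x\in C$ and every path $x=x_0\sim x_1\sim\dots\sim x_n=y$ in $U$ with $b(x_i,x_{i+1})\simeq b(x_i)$ for all $i=0,\dots,n-1$, one has $b(x)\simeq b(y)$.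
   Formalization: In (a), second sentence, it is also assumed that π(x,y)=0 for all x in the finite essential component and y in V∖U; without this it fails (V={x,y}, U={x}). One-vertex V is excluded, since p is undefined there. *)

theory Defs
  imports "HOL-Probability.Probability"
begin

section \<open>Comparability and real part in an ordered field\<close>

definition simeq :: "'k::linordered_field \<Rightarrow> 'k \<Rightarrow> bool" (infix "\<simeq>" 50) where
  "k1 \<simeq> k2 \<longleftrightarrow> 0 < k1 \<and> 0 < k2 \<and>
     (\<exists>c1 c2 :: rat. 0 < c1 \<and> 0 < c2 \<and> of_rat c1 < k1 / k2 \<and> k1 / k2 < of_rat c2)"

text \<open>
  The real part of a finite k is the real number r at infinitesimal distance from k.
  As k and r live in different fields, their distance is measured through rationals, which lie in
  both.  Lemma \<open>infinitely_close_iff\<close> shows that this is the distance in any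
  ordered field containing both fields.
\<close>

definition infinitely_close :: "'k::linordered_field \<Rightarrow> real \<Rightarrow> bool" where
  "infinitely_close k r \<longleftrightarrow>
     (\<forall>e::rat. 0 < e \<longrightarrow> (\<exists>q::rat. \<bar>k - of_rat q\<bar> < of_rat e \<and> \<bar>r - of_rat q\<bar> < of_rat e))"

definition real_part :: "'k::linordered_field \<Rightarrow> real" where
  "real_part k = (THE r. infinitely_close k r)"

definition ordered_field_embedding :: "('k::linordered_field \<Rightarrow> 'f::linordered_field) \<Rightarrow> bool" where
  "ordered_field_embedding f \<longleftrightarrow> f 1 = 1 \<and>
     (\<forall>x y. f (x + y) = f x + f y \<and> f (x * y) = f x * f y \<and> (x < y \<longleftrightarrow> f x < f y))"

lemma ordered_field_embedding_of_rat:
  fixes f :: "'k::linordered_field \<Rightarrow> 'f::linordered_field"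
  assumes "ordered_field_embedding f"
  shows "f (of_rat q) = of_rat q"
proof -
  have one: "f 1 = 1" and add: "\<And>x y. f (x + y) = f x + f y" and mult: "\<And>x y. f (x * y) = f x * f y"
    using assms by (auto simp: ordered_field_embedding_def)
  have zero: "f 0 = 0" using add[of 0 0] by simp
  have neg: "f (- x) = - f x" for x using add[of x "-x"] zero by (simp add: eq_neg_iff_add_eq_0 add.commute)
  have nat: "f (of_nat n) = of_nat n" for n by (induction n) (simp_all add: zero one add)
  have int: "f (of_int z) = of_int z" for z by (cases z rule: int_diff_cases) (simp add: add neg nat diff_conv_add_uminus del: add_uminus_conv_diff)
  obtain a b where q: "q = Fract a b" "b > 0" by (cases q) auto
  have "f (of_rat q) * f (of_int b) = f (of_int a)"
    using q by (simp add: mult[symmetric] of_rat_rat)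
  then show ?thesis using q by (simp add: int of_rat_rat field_simps)
qed

lemma infinitely_close_iff:
  fixes f :: "'k::linordered_field \<Rightarrow> 'f::linordered_field" and g :: "real \<Rightarrow> 'f"
  assumes f: "ordered_field_embedding f" and g: "ordered_field_embedding g"
  shows "infinitely_close k r \<longleftrightarrow> (\<forall>e::rat. 0 < e \<longrightarrow> \<bar>f k - g r\<bar> < of_rat e)"
proof -
  have fr: "f x < of_rat q \<longleftrightarrow> x < of_rat q" "of_rat q < f x \<longleftrightarrow> of_rat q < x" for x q
    using f ordered_field_embedding_of_rat[OF f, of q] by (metis ordered_field_embedding_def)+
  have gr: "g x < of_rat q \<longleftrightarrow> x < of_rat q" "of_rat q < g x \<longleftrightarrow> of_rat q < x" for x q
    using g ordered_field_embedding_of_rat[OF g, of q] by (metis ordered_field_embedding_def)+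
  have fa: "\<bar>k - of_rat q\<bar> < of_rat e \<longleftrightarrow> \<bar>f k - of_rat q\<bar> < of_rat e" for q e
    using fr(1)[of k "q + e"] fr(2)[of "q - e" k] by (auto simp: abs_less_iff of_rat_add of_rat_diff algebra_simps)
  have ga: "\<bar>r - of_rat q\<bar> < of_rat e \<longleftrightarrow> \<bar>g r - of_rat q\<bar> < of_rat e" for q e
    using gr(1)[of r "q + e"] gr(2)[of "q - e" r] by (auto simp: abs_less_iff of_rat_add of_rat_diff algebra_simps)
  show ?thesis
  proof (intro iffI allI impI)
    fix e :: rat assume e: "0 < e" and "infinitely_close k r"
    then obtain q :: rat where q: "\<bar>f k - of_rat q\<bar> < of_rat (e / 2)" "\<bar>g r - of_rat q\<bar> < of_rat (e / 2)"
      unfolding infinitely_close_def fa ga by (meson half_gt_zero)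
    have "of_rat e = of_rat (e / 2) + (of_rat (e / 2) :: 'f)"
      by (simp flip: of_rat_add)
    with q show "\<bar>f k - g r\<bar> < of_rat e" by linarith
  next
    assume *: "\<forall>e::rat. 0 < e \<longrightarrow> \<bar>f k - g r\<bar> < of_rat e"
    show "infinitely_close k r" unfolding infinitely_close_def
    proof (intro allI impI)
      fix e :: rat assume e: "0 < e"
      obtain q where q: "r - of_rat (e / 2) < of_rat q" "of_rat q < r"
        using of_rat_dense[of "r - of_rat (e / 2)" r] e by auto
      then have "\<bar>r - of_rat q\<bar> < of_rat (e / 2)" by auto
      moreover have "\<bar>f k - g r\<bar> < of_rat (e / 2)" using * e by simp
      moreover have "of_rat e = of_rat (e / 2) + (of_rat (e / 2) :: 'f)" "of_rat (e / 2) > (0::'f)"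
        using e by (simp_all flip: of_rat_add)
      ultimately have "\<bar>f k - of_rat q\<bar> < of_rat e" "\<bar>g r - of_rat q\<bar> < of_rat e"
        unfolding ga by linarith+
      then show "\<exists>q::rat. \<bar>k - of_rat q\<bar> < of_rat e \<and> \<bar>r - of_rat q\<bar> < of_rat e"
        unfolding fa ga by blast
    qed
  qed
qed

section \<open>Weighted graphs\<close>

definition weighted_graph :: "'v set \<Rightarrow> ('v \<Rightarrow> 'v \<Rightarrow> 'k::linordered_field) \<Rightarrow> bool" where
  "weighted_graph V b \<longleftrightarrow>
     (\<forall>x\<in>V. \<forall>y\<in>V. 0 \<le> b x y \<and> b x y = b y x) \<and> (\<forall>x\<in>V. b x x = 0)"

definition neighbors :: "'v set \<Rightarrow> ('v \<Rightarrow> 'v \<Rightarrow> 'k::linordered_field) \<Rightarrow> 'v \<Rightarrow> 'v set" where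
  "neighbors V b x = {y \<in> V. 0 < b x y}"

definition locally_finite_graph :: "'v set \<Rightarrow> ('v \<Rightarrow> 'v \<Rightarrow> 'k::linordered_field) \<Rightarrow> bool" where
  "locally_finite_graph V b \<longleftrightarrow> (\<forall>x\<in>V. finite (neighbors V b x))"

text \<open>A path is the nonempty list of its vertices; the singleton list is the path with n = 0.\<close>

definition path_in :: "'v set \<Rightarrow> ('v \<Rightarrow> 'v \<Rightarrow> 'k::linordered_field) \<Rightarrow> 'v \<Rightarrow> 'v list \<Rightarrow> 'v \<Rightarrow> bool" where
  "path_in U b x xs y \<longleftrightarrow> xs \<noteq> [] \<and> hd xs = x \<and> last xs = y \<and> set xs \<subseteq> U \<and>
     (\<forall>i. Suc i < length xs \<longrightarrow> 0 < b (xs ! i) (xs ! Suc i))"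

definition connected_graph :: "'v set \<Rightarrow> ('v \<Rightarrow> 'v \<Rightarrow> 'k::linordered_field) \<Rightarrow> bool" where
  "connected_graph V b \<longleftrightarrow> (\<forall>x\<in>V. \<forall>y\<in>V. \<exists>xs. path_in V b x xs y)"

text \<open>
  The sum of b x y over all y in V, restricted to the finitely many nonzero terms
  because a \<open>sum\<close> over an infinite set is 0.
\<close>

definition vweight :: "'v set \<Rightarrow> ('v \<Rightarrow> 'v \<Rightarrow> 'k::linordered_field) \<Rightarrow> 'v \<Rightarrow> 'k" where
  "vweight V b x = (\<Sum>y\<in>neighbors V b x. b x y)"

definition trans_prob :: "'v set \<Rightarrow> ('v \<Rightarrow> 'v \<Rightarrow> 'k::linordered_field) \<Rightarrow> 'v \<Rightarrow> 'v \<Rightarrow> 'k" where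
  "trans_prob V b x y = b x y / vweight V b x"

definition real_trans ::
    "'v set \<Rightarrow> 'v set \<Rightarrow> ('v \<Rightarrow> 'v \<Rightarrow> 'k::linordered_field) \<Rightarrow> 'v \<Rightarrow> 'v \<Rightarrow> real" where
  "real_trans V U b x y =
     (if x \<in> U then real_part (trans_prob V b x y) else if x = y then 1 else 0)"

section \<open>Components\<close>

definition strongly_connected ::
    "'v set \<Rightarrow> 'v set \<Rightarrow> ('v \<Rightarrow> 'v \<Rightarrow> 'k::linordered_field) \<Rightarrow> 'v set \<Rightarrow> bool" where
  "strongly_connected V U b C \<longleftrightarrow> C \<subseteq> U \<and>
     (\<forall>x\<in>C. \<forall>y\<in>C. \<exists>xs. path_in U b x xs y \<and>
        (\<forall>i. Suc i < length xs \<longrightarrow>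
           vweight V b x \<simeq> b (xs ! i) (xs ! Suc i) \<and> b (xs ! i) (xs ! Suc i) \<simeq> vweight V b y))"

definition strong_component ::
    "'v set \<Rightarrow> 'v set \<Rightarrow> ('v \<Rightarrow> 'v \<Rightarrow> 'k::linordered_field) \<Rightarrow> 'v set \<Rightarrow> bool" where
  "strong_component V U b C \<longleftrightarrow> strongly_connected V U b C \<and>
     (\<forall>D. strongly_connected V U b D \<and> C \<subseteq> D \<longrightarrow> D = C)"

definition essential_component ::
    "'v set \<Rightarrow> 'v set \<Rightarrow> ('v \<Rightarrow> 'v \<Rightarrow> 'k::linordered_field) \<Rightarrow> 'v set \<Rightarrow> bool" where
  "essential_component V U b C \<longleftrightarrow> strong_component V U b C \<and>
     (\<forall>x\<in>C. \<forall>y xs. path_in U b x xs y \<and>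
        (\<forall>i. Suc i < length xs \<longrightarrow> b (xs ! i) (xs ! Suc i) \<simeq> vweight V b (xs ! i)) \<longrightarrow>
        vweight V b x \<simeq> vweight V b y)"

section \<open>Markov chains, recurrence and transience\<close>

definition markov_chain ::
    "'a measure \<Rightarrow> (nat \<Rightarrow> 'a \<Rightarrow> 'v) \<Rightarrow> 'v set \<Rightarrow> ('v \<Rightarrow> 'v \<Rightarrow> real) \<Rightarrow> 'v \<Rightarrow> bool" where
  "markov_chain M X V P x \<longleftrightarrow> prob_space M \<and>
     (\<forall>n. X n \<in> M \<rightarrow>\<^sub>M count_space V) \<and>
     \<P>(\<omega> in M. X 0 \<omega> = x) = 1 \<and>
     (\<forall>n s. (\<forall>i\<le>Suc n. s i \<in> V) \<longrightarrow>
        \<P>(\<omega> in M. \<forall>i\<le>Suc n. X i \<omega> = s i) = \<P>(\<omega> in M. \<forall>i\<le>n. X i \<omega> = s i) * P (s n) (s (Suc n)))"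

text \<open>
  The probability of returning infinitely often depends only on the law of the chain, so
  the realization is immaterial.  The sample space can be taken to be the path space, and
  lemma \<open>markov_chain_exists\<close> provides a realization for every stochastic matrix.
\<close>

definition recurrent ::
    "'v set \<Rightarrow> 'v set \<Rightarrow> ('v \<Rightarrow> 'v \<Rightarrow> 'k::linordered_field) \<Rightarrow> 'v \<Rightarrow> bool" where
  "recurrent V U b x \<longleftrightarrow> x \<in> U \<and>
     (\<forall>(M :: (nat \<Rightarrow> 'v) measure) X. markov_chain M X V (real_trans V U b) x \<longrightarrow>
        \<P>(\<omega> in M. \<exists>\<^sub>\<infinity>n. X n \<omega> = x) = 1)"

definition transient ::
    "'v set \<Rightarrow> 'v set \<Rightarrow> ('v \<Rightarrow> 'v \<Rightarrow> 'k::linordered_field) \<Rightarrow> 'v \<Rightarrow> bool" where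
  "transient V U b x \<longleftrightarrow> x \<in> U \<and> \<not> recurrent V U b x"

lemma markov_chain_exists:
  fixes V :: "'v set" and P :: "'v \<Rightarrow> 'v \<Rightarrow> real"
  assumes V: "countable V" and x: "x \<in> V"
    and nonneg: "\<And>u v. u \<in> V \<Longrightarrow> v \<in> V \<Longrightarrow> 0 \<le> P u v"
    and stoch: "\<And>u. u \<in> V \<Longrightarrow> (\<integral>\<^sup>+v. ennreal (P u v) \<partial>count_space V) = 1"
  shows "\<exists>(M :: (nat \<Rightarrow> 'v) measure) X. markov_chain M X V P x"
proof -
  define N where "N = (\<lambda>(i::nat, u). if u \<in> V then density (count_space V) (\<lambda>v. ennreal (P u v))
      else return (count_space V) x)"
  have N: "prob_space (N j)" for j
  proof -
    have "(\<integral>\<^sup>+v. ennreal (P u v) * indicator V v \<partial>count_space V) = 1" if "u \<in> V" for u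
      using stoch[OF that] by (subst nn_integral_cong[where v="\<lambda>v. ennreal (P u v)"]) auto
    then show ?thesis
      by (auto simp: N_def x emeasure_density intro!: prob_spaceI prob_space_return split: prod.split)
  qed
  have spN: "space (N j) = V" and seN: "sets (N j) = Pow V" for j
    by (auto simp: N_def split: prod.split)
  define Q where "Q = PiM UNIV N"
  interpret Q: product_prob_space N UNIV
    using N by (simp add: product_prob_space_def product_prob_space_axioms_def product_sigma_finite_def
        prob_space_imp_sigma_finite)
  have Q_prob: "prob_space Q" unfolding Q_def by (rule Q.prob_space_axioms)
  define Y where "Y = rec_nat (\<lambda>\<omega>::nat \<times> 'v \<Rightarrow> 'v. x) (\<lambda>n Yn \<omega>. \<omega> (n, Yn \<omega>))"
  have Y0: "Y 0 \<omega> = x" and YS: "Y (Suc n) \<omega> = \<omega> (n, Y n \<omega>)" for n \<omega>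
    by (simp_all add: Y_def)
  have comp: "(\<lambda>\<omega>. \<omega> j) \<in> Q \<rightarrow>\<^sub>M count_space V" for j
  proof -
    have "(\<lambda>\<omega>. \<omega> j) \<in> Q \<rightarrow>\<^sub>M N j"
      unfolding Q_def by (rule measurable_component_singleton) simp
    moreover have "Q \<rightarrow>\<^sub>M N j = Q \<rightarrow>\<^sub>M count_space V"
      by (rule measurable_cong_sets) (simp_all add: seN)
    ultimately show ?thesis by blast
  qed
  have Y_meas: "Y n \<in> Q \<rightarrow>\<^sub>M count_space V" for n
  proof (induction n)
    case 0
    have "Y 0 = (\<lambda>\<omega>. x)" by (simp add: fun_eq_iff Y0)
    then show ?case using x by simp
  next
    case (Suc n)
    have "(\<lambda>\<omega>. (\<lambda>u \<omega>. \<omega> (n, u)) (Y n \<omega>) \<omega>) \<in> Q \<rightarrow>\<^sub>M count_space V"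
      by (rule measurable_compose_countable'[OF _ Suc V]) (rule comp)
    moreover have "Y (Suc n) = (\<lambda>\<omega>. \<omega> (n, Y n \<omega>))" by (simp add: fun_eq_iff YS)
    ultimately show ?case by simp
  qed
  have path: "(\<forall>i\<le>m. Y i \<omega> = s i) \<longleftrightarrow> s 0 = x \<and> (\<forall>i<m. \<omega> (i, s i) = s (Suc i))" for m s \<omega>
  proof (induction m)
    case 0 then show ?case by (auto simp: Y0)
  next
    case (Suc m)
    then show ?case by (auto simp: le_Suc_eq less_Suc_eq YS)
  qed
  have cyl: "\<P>(\<omega> in Q. \<forall>i<m. \<omega> (i, s i) = s (Suc i)) = (\<Prod>i<m. P (s i) (s (Suc i)))"
    if s: "\<forall>i\<le>m. s i \<in> V" for m s
  proof -
    define J where "J = (\<lambda>i. (i, s i)) ` {..<m}"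
    have "{\<omega> \<in> space Q. \<forall>i<m. \<omega> (i, s i) = s (Suc i)} =
        prod_emb UNIV N J (Pi\<^sub>E J (\<lambda>j. {s (Suc (fst j))}))"
      by (auto simp: Q_def prod_emb_iff space_PiM PiE_iff J_def spN extensional_def)
    moreover have "emeasure Q (prod_emb UNIV N J (Pi\<^sub>E J (\<lambda>j. {s (Suc (fst j))})))
        = (\<Prod>j\<in>J. emeasure (N j) {s (Suc (fst j))})"
      unfolding Q_def using s by (intro Q.emeasure_PiM_emb) (auto simp: J_def seN)
    moreover have "\<dots> = (\<Prod>i<m. emeasure (N (i, s i)) {s (Suc i)})"
      unfolding J_def by (subst prod.reindex) (auto simp: inj_on_def)
    moreover have "\<dots> = (\<Prod>i<m. ennreal (P (s i) (s (Suc i))))"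
      using s by (intro prod.cong) (auto simp: N_def emeasure_density nn_integral_count_space_indicator
          nn_integral_indicator_singleton)
    moreover have "\<dots> = ennreal (\<Prod>i<m. P (s i) (s (Suc i)))"
      using s nonneg by (intro prod_ennreal) auto
    moreover have "0 \<le> (\<Prod>i<m. P (s i) (s (Suc i)))"
      using s nonneg by (intro prod_nonneg) auto
    ultimately show ?thesis
      by (simp add: measure_def)
  qed
  define M where "M = distr Q (PiM UNIV (\<lambda>_::nat. count_space V)) (\<lambda>\<omega> n. Y n \<omega>)"
  have Ym: "(\<lambda>\<omega> n. Y n \<omega>) \<in> Q \<rightarrow>\<^sub>M PiM UNIV (\<lambda>_::nat. count_space V)"
    using Y_meas measurable_space[OF Y_meas]
    by (intro measurable_PiM_single') (auto simp: PiE_iff)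
  have M_prob: "prob_space M"
    unfolding M_def by (rule prob_space.prob_space_distr[OF Q_prob Ym])
  have X_meas: "(\<lambda>\<omega>. \<omega> n) \<in> M \<rightarrow>\<^sub>M count_space V" for n
    unfolding M_def by simp
  have fin: "\<P>(\<omega> in M. \<forall>i\<le>m. \<omega> i = s i) = (if s 0 = x then \<Prod>i<m. P (s i) (s (Suc i)) else 0)"
    if s: "\<forall>i\<le>m. s i \<in> V" for m s
  proof -
    have ms: "{\<omega> \<in> space (PiM UNIV (\<lambda>_::nat. count_space V)). \<forall>i\<le>m. \<omega> i = s i} \<in>
        sets (PiM UNIV (\<lambda>_::nat. count_space V))"
    proof -
      have "{\<omega> \<in> space (PiM UNIV (\<lambda>_::nat. count_space V)). \<omega> i = s i} \<in>
          sets (PiM UNIV (\<lambda>_::nat. count_space V))" if "i \<in> {..m}" for i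
        using measurable_sets[OF measurable_component_singleton[of i UNIV "\<lambda>_. count_space V"], of "{s i}"]
          s that by (simp add: vimage_def Int_def conj_commute)
      from sets.sets_Collect_finite_All[OF this, of "{..m}" "\<lambda>i. i"] show ?thesis by simp
    qed
    have "\<P>(\<omega> in M. \<forall>i\<le>m. \<omega> i = s i) = \<P>(\<omega> in Q. \<forall>i\<le>m. Y i \<omega> = s i)"
      unfolding M_def using measure_distr[OF Ym ms] measurable_space[OF Ym]
      by (auto intro!: arg_cong[where f="measure Q"])
    also have "\<dots> = (if s 0 = x then \<Prod>i<m. P (s i) (s (Suc i)) else 0)"
      unfolding path using cyl[OF s] by simp
    finally show ?thesis .
  qed
  have "markov_chain M (\<lambda>n \<omega>. \<omega> n) V P x"
    unfolding markov_chain_def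
  proof (intro conjI allI impI)
    show "\<P>(\<omega> in M. \<omega> 0 = x) = 1" using fin[of 0 "\<lambda>_. x"] x by simp
    fix n s assume "\<forall>i\<le>Suc n. s i \<in> V"
    then show "\<P>(\<omega> in M. \<forall>i\<le>Suc n. \<omega> i = s i) =
        \<P>(\<omega> in M. \<forall>i\<le>n. \<omega> i = s i) * P (s n) (s (Suc n))"
      using fin[of "Suc n" s] fin[of n s] by simp
  qed (use M_prob X_meas in auto)
  then show ?thesis by blast
qed

section \<open>Leaving U from an essential component\<close>

text \<open>
  Paths in U do not see edges from U to its complement, so a finite essential component C may be
  left forever through such an edge.  The finiteness criterion for recurrence therefore needs that
  the chain has no transition from C to the complement of U, which is automatic for U = V.  Lemma
  \<open>finite_essential_not_recurrent\<close> shows that it fails otherwise:  on a single edge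
  with U one of its two vertices, U is a finite essential component, but its vertex is transient.
\<close>

lemma real_part_of_rat: "real_part (of_rat a :: 'k::linordered_field) = of_rat a"
  unfolding real_part_def
proof (rule the_equality)
  show "infinitely_close (of_rat a :: 'k) (of_rat a)"
    unfolding infinitely_close_def by (auto intro!: exI[of _ a])
  fix r assume r: "infinitely_close (of_rat a :: 'k) r"
  show "r = of_rat a"
  proof (rule ccontr)
    assume "r \<noteq> of_rat a"
    then obtain e :: rat where e: "0 < real_of_rat e" "real_of_rat e < \<bar>r - of_rat a\<bar> / 2"
      using of_rat_dense[of 0 "\<bar>r - of_rat a\<bar> / 2"] by auto
    then obtain q :: rat where q: "\<bar>of_rat a - of_rat q :: 'k\<bar> < of_rat e" "\<bar>r - of_rat q\<bar> < of_rat e"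
      using r unfolding infinitely_close_def by auto
    have "\<bar>a - q\<bar> < e"
      using q(1) by (simp add: of_rat_less flip: of_rat_diff)
    then have "\<bar>real_of_rat a - of_rat q\<bar> < of_rat e"
      by (simp add: of_rat_less flip: of_rat_diff)
    moreover have "\<bar>r - of_rat a\<bar> \<le> \<bar>r - of_rat q\<bar> + \<bar>real_of_rat a - of_rat q\<bar>"
      using abs_triangle_ineq4[of "r - of_rat q" "real_of_rat a - of_rat q"] by simp
    ultimately show False using q(2) e(2) by simp
  qed
qed

lemma finite_essential_not_recurrent:
  fixes b :: "bool \<Rightarrow> bool \<Rightarrow> 'k::linordered_field"
  defines "b \<equiv> \<lambda>x y. if x = y then 0 else 1"
  shows "weighted_graph UNIV b" "connected_graph UNIV b" "locally_finite_graph UNIV b"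
    "essential_component UNIV {False} b {False}" "finite {False}"
    "\<not> recurrent UNIV {False} b False"
proof -
  have nb: "neighbors UNIV b x = {\<not> x}" for x
    by (auto simp: neighbors_def b_def)
  have vw: "vweight UNIV b x = 1" for x
    by (simp add: vweight_def nb) (simp add: b_def)
  have one: "(1::'k) \<simeq> 1"
    unfolding simeq_def by (intro conjI exI[of _ "1/2"] exI[of _ 2]) (simp_all add: of_rat_divide)
  show "weighted_graph UNIV b" "locally_finite_graph UNIV b" "finite {False}"
    by (auto simp: weighted_graph_def locally_finite_graph_def nb b_def)
  show "connected_graph UNIV b"
    unfolding connected_graph_def
  proof (intro ballI)
    fix x y
    show "\<exists>xs. path_in UNIV b x xs y"
      by (intro exI[of _ "if x = y then [x] else [x, y]"]) (auto simp: path_in_def b_def less_Suc_eq)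
  qed
  have sc: "strongly_connected UNIV {False} b {False}"
    unfolding strongly_connected_def path_in_def by (auto intro!: exI[of _ "[False]"])
  then show "essential_component UNIV {False} b {False}"
    unfolding essential_component_def strong_component_def
    by (auto simp: strongly_connected_def vw one)
  define M :: "(nat \<Rightarrow> bool) measure" where "M = return (count_space UNIV) undefined"
  define X where "X = (\<lambda>(n::nat) (\<omega>::nat \<Rightarrow> bool). 0 < n)"
  have M: "prob_space M" unfolding M_def by (rule prob_space_return) simp
  have rt: "real_trans UNIV {False} b x y = (if y then 1 else 0)" for x y
    using real_part_of_rat[of 0, where 'k='k] real_part_of_rat[of 1, where 'k='k]
    unfolding real_trans_def trans_prob_def vw by (cases x; cases y) (simp_all add: b_def)
  have pr: "measure M {\<omega> \<in> space M. Q} = (if Q then 1 else 0)" for Q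
    using prob_space.prob_space[OF M] by simp
  have "markov_chain M X UNIV (real_trans UNIV {False} b) False"
    unfolding markov_chain_def rt X_def pr using M
    by (auto simp: le_Suc_eq M_def)
  moreover have "\<P>(\<omega> in M. \<exists>\<^sub>\<infinity>n. X n \<omega> = False) \<noteq> 1"
    by (simp add: X_def pr)
  ultimately show "\<not> recurrent UNIV {False} b False"
    unfolding recurrent_def by blast
qed

end

(*
  The real chain steps from x in U to y with positive probability iff b(x,y) ~ b(x).  Since
  b(y) >= b(x,y), the weight cannot drop to a smaller class along such steps, and from a vertex in a
  non-essential component the chain reaches, with positive probability, a vertex of strictly
  larger class, from which it never returns.  Conversely, an essential component
  without transitions out of U is closed and irreducible for the chain; if it is finite, then the
  probability h of avoiding x forever vanishes by the maximum principle.
*)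
theory Submission
  imports Defs
begin

section \<open>Domination up to rational factors\<close>

text \<open>The Markov property is available only for complete histories up to a fixed time, so no
  stopping times occur. Almost-sure statements are split over finite histories, stored as lists of
  vertices; there are countably many of them, and each contributes a null set. Recurrence quantifies
  over all realizations: proving it means treating an arbitrary chain, refuting it requires a
  concrete chain and hence a stochastic matrix. Weights and real parts live in different fields, so
  every comparison between them passes through rationals. The preorder \<open>dominated\<close> is
  the one-sided version of \<open>simeq\<close>, needed because weights are only known to climb
  along transitions.\<close>

definition dominated :: "'k::linordered_field \<Rightarrow> 'k \<Rightarrow> bool" where
  "dominated l k \<longleftrightarrow> (\<exists>c::rat. 0 < c \<and> of_rat c * l \<le> k)"

lemma dominated_if_le: "l \<le> k \<Longrightarrow> dominated l k"
  unfolding dominated_def by (intro exI[of _ 1]) simp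

lemma dominated_trans:
  assumes "dominated k l" "dominated l m"
  shows "dominated k m"
proof -
  obtain c d :: rat where cd: "0 < c" "of_rat c * k \<le> l" "0 < d" "of_rat d * l \<le> m"
    using assms unfolding dominated_def by blast
  have "of_rat (d * c) * k = of_rat d * (of_rat c * k)" by (simp add: of_rat_mult)
  also have "\<dots> \<le> of_rat d * l" using cd by (intro mult_left_mono) auto
  finally show ?thesis
    unfolding dominated_def using cd by (intro exI[of _ "d * c"]) auto
qed

lemma simeq_iff_dominated: "k \<simeq> l \<longleftrightarrow> 0 < k \<and> 0 < l \<and> dominated k l \<and> dominated l k"
proof (cases "0 < k \<and> 0 < l")
  case True
  then have pos: "0 < k" "0 < l" by auto
  show ?thesis
  proof
    assume "k \<simeq> l"
    then obtain c d :: rat where cd: "0 < c" "0 < d" "of_rat c < k / l" "k / l < of_rat d"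
      unfolding simeq_def by blast
    then have "of_rat c * l \<le> k" "of_rat (inverse d) * k \<le> l"
      using pos by (auto simp: field_simps of_rat_divide)
    then show "0 < k \<and> 0 < l \<and> dominated k l \<and> dominated l k"
      using cd pos unfolding dominated_def by (meson positive_imp_inverse_positive)
  next
    assume "0 < k \<and> 0 < l \<and> dominated k l \<and> dominated l k"
    then obtain c d :: rat where cd: "0 < c" "of_rat c * k \<le> l" "0 < d" "of_rat d * l \<le> k"
      unfolding dominated_def by blast
    \<comment> \<open>\<open>dominated\<close> gives weak bounds and \<open>simeq\<close> asks for
      strict ones; halving \<open>d\<close> and doubling \<open>1 / c\<close> makes the
      room.\<close>
    have "of_rat (d / 2) < k / l"
    proof -
      have "of_rat (d / 2) < (of_rat d :: 'a)" using cd by (simp add: of_rat_less)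
      also have "\<dots> \<le> k / l" using cd pos by (simp add: field_simps)
      finally show ?thesis .
    qed
    moreover have "k / l < of_rat (2 / c)"
    proof -
      have "k / l \<le> of_rat (1 / c)" using cd pos by (simp add: field_simps of_rat_divide)
      also have "\<dots> < (of_rat (2 / c) :: 'a)" using cd by (simp add: of_rat_less divide_strict_right_mono)
      finally show ?thesis .
    qed
    ultimately show "k \<simeq> l"
      unfolding simeq_def using cd pos by (intro conjI exI[of _ "d / 2"] exI[of _ "2 / c"]) auto
  qed
qed (auto simp: simeq_def)

lemma simeq_sym: "k \<simeq> l \<Longrightarrow> l \<simeq> k"
  by (auto simp: simeq_iff_dominated)

lemma simeq_trans: "k \<simeq> l \<Longrightarrow> l \<simeq> m \<Longrightarrow> k \<simeq> m"
  unfolding simeq_iff_dominated by (metis dominated_trans)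

lemma simeq_refl: "0 < k \<Longrightarrow> k \<simeq> k"
  by (auto simp: simeq_iff_dominated intro: dominated_if_le)

section \<open>Real parts\<close>

lemma infinitely_close_of_rat: "infinitely_close (of_rat a) (of_rat a)"
  unfolding infinitely_close_def by (auto intro!: exI[of _ a])

lemma infinitely_close_add:
  assumes "infinitely_close k r" "infinitely_close l s"
  shows "infinitely_close (k + l) (r + s)"
  unfolding infinitely_close_def
proof (intro allI impI)
  fix e :: rat assume "0 < e"
  then have "0 < e / 2" by simp
  then obtain p q :: rat where
    pq: "\<bar>k - of_rat p\<bar> < of_rat (e / 2)" "\<bar>r - of_rat p\<bar> < of_rat (e / 2)"
        "\<bar>l - of_rat q\<bar> < of_rat (e / 2)" "\<bar>s - of_rat q\<bar> < of_rat (e / 2)"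
    using assms unfolding infinitely_close_def by meson
  have e: "of_rat e = of_rat (e / 2) + (of_rat (e / 2) :: 'a)"
    "of_rat e = of_rat (e / 2) + (of_rat (e / 2) :: real)"
    by (simp_all flip: of_rat_add)
  have "\<bar>(k + l) - of_rat (p + q)\<bar> < of_rat e"
    unfolding e(1) of_rat_add using pq(1,3) by linarith
  moreover have "\<bar>(r + s) - of_rat (p + q)\<bar> < of_rat e"
    unfolding e(2) of_rat_add using pq(2,4) by linarith
  ultimately show "\<exists>q::rat. \<bar>(k + l) - of_rat q\<bar> < of_rat e \<and> \<bar>(r + s) - of_rat q\<bar> < of_rat e"
    by blast
qed

lemma infinitely_close_mono:
  assumes "infinitely_close k r" "infinitely_close l s" "k \<le> l"
  shows "r \<le> s"
proof (rule ccontr)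
  assume "\<not> r \<le> s"
  \<comment> \<open>A quarter of the gap, because four errors add up: \<open>r < p + e\<close>,
    \<open>p < q + 2 e\<close> and \<open>q < s + e\<close> give \<open>r - s < 4 e\<close>. The
    middle inequality is proved in the field of \<open>k\<close> and transferred, being one between
    rationals.\<close>
  then obtain e :: rat where e: "0 < real_of_rat e" "real_of_rat e < (r - s) / 4"
    using of_rat_dense[of 0 "(r - s) / 4"] by auto
  then obtain p q :: rat where
    pq: "\<bar>k - of_rat p\<bar> < of_rat e" "\<bar>r - of_rat p\<bar> < of_rat e"
        "\<bar>l - of_rat q\<bar> < of_rat e" "\<bar>s - of_rat q\<bar> < of_rat e"
    using assms(1,2) unfolding infinitely_close_def zero_less_of_rat_iff by meson
  have "(of_rat p :: 'a) < of_rat (q + e + e)"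
    unfolding of_rat_add using pq(1,3) assms(3) by linarith
  then have "real_of_rat p < of_rat (q + e + e)"
    by (simp only: of_rat_less)
  then show False
    using pq(2,4) e unfolding of_rat_add abs_less_iff by argo
qed

lemma infinitely_close_unique: "infinitely_close k r \<Longrightarrow> infinitely_close k s \<Longrightarrow> r = s"
  using infinitely_close_mono[of k r k s] infinitely_close_mono[of k s k r] by simp

text \<open>The real part is a Dedekind cut: the supremum of the rationals below \<open>k\<close>.
  The two bounds on \<open>k\<close> make this set nonempty and bounded.\<close>

lemma infinitely_close_exists:
  assumes "of_rat a \<le> k" "k \<le> of_rat d"
  shows "\<exists>r. infinitely_close k r"
proof -
  define A where "A = {real_of_rat q | q. of_rat q \<le> k}"
  have ne: "A \<noteq> {}" using assms by (auto simp: A_def)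
  have "x \<le> of_rat d" if x: "x \<in> A" for x
  proof -
    obtain q where q: "x = of_rat q" "of_rat q \<le> k" using x by (auto simp: A_def)
    then have "(of_rat q :: 'a) \<le> of_rat d" using assms by simp
    then show ?thesis using q by (simp add: of_rat_less_eq)
  qed
  then have bdd: "bdd_above A" by (rule bdd_aboveI)
  have "infinitely_close k (Sup A)" unfolding infinitely_close_def
  proof (intro allI impI)
    fix e :: rat assume e: "0 < e"
    have e2: "real_of_rat (e / 2) > 0" "real_of_rat e = of_rat (e / 2) + of_rat (e / 2)"
      using e by (simp_all flip: of_rat_add)
    have "Sup A - of_rat (e / 2) < Sup A" using e2 by simp
    then obtain q where q: "of_rat q \<le> k" "Sup A - of_rat (e / 2) < of_rat q"
      unfolding less_cSup_iff[OF ne bdd] by (auto simp: A_def)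
    have "real_of_rat q \<le> Sup A"
      using q by (intro cSup_upper[OF _ bdd]) (auto simp: A_def)
    then have "\<bar>Sup A - of_rat q\<bar> < of_rat e" using q(2) e2 by linarith
    moreover have "k < of_rat (q + e / 2)"
    proof (rule ccontr)
      assume "\<not> k < of_rat (q + e / 2)"
      then have "real_of_rat (q + e / 2) \<le> Sup A"
        by (intro cSup_upper[OF _ bdd]) (auto simp: A_def)
      then show False using q(2) by (simp add: of_rat_add)
    qed
    moreover have "(of_rat (q + e / 2) :: 'a) < of_rat q + of_rat e"
      using e by (simp add: of_rat_less flip: of_rat_add)
    ultimately have "\<bar>k - of_rat q\<bar> < of_rat e \<and> \<bar>Sup A - of_rat q\<bar> < of_rat e"
      using q(1) by linarith
    then show "\<exists>q::rat. \<bar>k - of_rat q\<bar> < of_rat e \<and> \<bar>Sup A - of_rat q\<bar> < of_rat e"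
      by blast
  qed
  then show ?thesis ..
qed

lemma real_part_eqI: "infinitely_close k r \<Longrightarrow> real_part k = r"
  unfolding real_part_def using infinitely_close_unique by (intro the_equality)

lemma infinitely_close_real_part:
  assumes "0 \<le> k" "k \<le> 1"
  shows "infinitely_close k (real_part k)"
  using infinitely_close_exists[of 0 k 1] assms real_part_eqI by auto

lemma real_part_nonneg:
  assumes "0 \<le> k" "k \<le> 1"
  shows "0 \<le> real_part k"
  using infinitely_close_mono[OF _ infinitely_close_real_part[OF assms], of 0 0]
    infinitely_close_of_rat[of 0] assms by simp

text \<open>Closeness preserves weak inequalities, and a rational is close to itself, so a rational
  strictly between 0 and the real part cannot exceed \<open>k\<close>, and one below
  \<open>k\<close> cannot exceed the real part. This turns positive transition probability into
  comparability of weights.\<close>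

lemma real_part_pos_iff:
  assumes "0 \<le> k" "k \<le> 1"
  shows "0 < real_part k \<longleftrightarrow> (\<exists>c::rat. 0 < c \<and> of_rat c \<le> k)"
proof
  assume "0 < real_part k"
  then obtain c :: rat where c: "0 < real_of_rat c" "of_rat c < real_part k"
    using of_rat_dense by blast
  have "of_rat c \<le> k"
  proof (rule ccontr)
    assume "\<not> of_rat c \<le> k"
    then have "real_part k \<le> of_rat c"
      by (intro infinitely_close_mono[OF infinitely_close_real_part[OF assms]
            infinitely_close_of_rat]) simp
    then show False using c by simp
  qed
  then show "\<exists>c::rat. 0 < c \<and> of_rat c \<le> k" using c by auto
next
  assume "\<exists>c::rat. 0 < c \<and> of_rat c \<le> k"
  then obtain c :: rat where c: "0 < c" "of_rat c \<le> k" by blast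
  have "of_rat c \<le> real_part k"
    by (rule infinitely_close_mono[OF infinitely_close_of_rat infinitely_close_real_part[OF assms] c(2)])
  moreover have "0 < real_of_rat c" using c by simp
  ultimately show "0 < real_part k" by linarith
qed

lemma infinitely_close_sum:
  assumes "\<And>i. i \<in> I \<Longrightarrow> infinitely_close (f i) (g i)"
  shows "infinitely_close (sum f I) (sum g I)"
  using assms
proof (induction I rule: infinite_finite_induct)
  case (insert i I)
  then show ?case by (simp add: infinitely_close_add)
qed (use infinitely_close_of_rat[of 0] in simp_all)

section \<open>Markov chains\<close>

lemma pred_markov_chain:
  assumes "markov_chain M X V P x"
  shows "Measurable.pred M (\<lambda>\<omega>. X i \<omega> \<in> A)"
    and "Measurable.pred M (\<lambda>\<omega>. X i \<omega> = v)"
proof -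
  have X: "X i \<in> M \<rightarrow>\<^sub>M count_space V" using assms by (simp add: markov_chain_def)
  show "Measurable.pred M (\<lambda>\<omega>. X i \<omega> \<in> A)"
    by (rule measurable_compose[OF X]) simp
  show "Measurable.pred M (\<lambda>\<omega>. X i \<omega> = v)"
    by (rule measurable_compose[OF X]) simp
qed

text \<open>A fixed history ending in a forbidden step has probability 0 by the Markov formula, and
  a countable \<open>V\<close> has only countably many finite histories. Times 0 to
  \<open>n + 1\<close> make a list of length \<open>n + 2\<close>.\<close>

lemma markov_chain_AE_steps:
  assumes mc: "markov_chain M X V P x" and V: "countable V"
  shows "AE \<omega> in M. \<forall>n. P (X n \<omega>) (X (Suc n) \<omega>) \<noteq> 0"
proof -
  interpret prob_space M using mc by (simp add: markov_chain_def)
  note [measurable] = pred_markov_chain[OF mc]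
  have XV: "X n \<omega> \<in> V" if "\<omega> \<in> space M" for n \<omega>
    using measurable_space[of "X n" M "count_space V" \<omega>] mc that by (simp add: markov_chain_def)
  have "AE \<omega> in M. \<not> (\<forall>i\<le>Suc n. X i \<omega> = xs ! i)"
    if xs: "xs \<in> lists V" "length xs = n + 2" "P (xs ! n) (xs ! Suc n) = 0" for xs n
  proof -
    have "\<forall>i\<le>Suc n. xs ! i \<in> V" using xs(1,2) by (auto simp: lists_eq_set)
    then have "\<P>(\<omega> in M. \<forall>i\<le>Suc n. X i \<omega> = xs ! i) = 0"
      using mc xs(3) unfolding markov_chain_def by auto
    then show ?thesis
      by (subst (asm) prob_eq_0) auto
  qed
  then have "AE \<omega> in M. \<forall>xs\<in>lists V. \<forall>n. length xs = n + 2 \<longrightarrow> P (xs ! n) (xs ! Suc n) = 0 \<longrightarrow>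
      \<not> (\<forall>i\<le>Suc n. X i \<omega> = xs ! i)"
    unfolding AE_ball_countable[OF countable_lists[OF V]] AE_all_countable by auto
  then show ?thesis using AE_space
  proof eventually_elim
    case (elim \<omega>)
    show ?case
    proof
      fix n
      define xs where "xs = map (\<lambda>i. X i \<omega>) [0..<n + 2]"
      have len: "length xs = n + 2" by (simp add: xs_def)
      have nth: "xs ! i = X i \<omega>" if "i \<le> Suc n" for i
        unfolding xs_def using that by (subst nth_map) (auto simp del: upt_Suc)
      have xsV: "xs \<in> lists V"
        unfolding xs_def using XV[OF elim(2)] by auto
      have "P (xs ! n) (xs ! Suc n) \<noteq> 0"
        using elim(1)[rule_format, OF xsV len] by (auto simp: nth)
      then show "P (X n \<omega>) (X (Suc n) \<omega>) \<noteq> 0" by (simp add: nth)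
    qed
  qed
qed

lemma markov_chain_cylinder_pos:
  assumes mc: "markov_chain M X V P x" and x: "x \<in> V"
    and path: "(\<lambda>u v. v \<in> V \<and> 0 < P u v)\<^sup>*\<^sup>* x y"
  shows "\<exists>n s. (\<forall>i\<le>n. s i \<in> V) \<and> s n = y \<and> 0 < \<P>(\<omega> in M. \<forall>i\<le>n. X i \<omega> = s i)"
  using path
proof (induction rule: rtranclp_induct)
  case base
  have "\<P>(\<omega> in M. \<forall>i\<le>(0::nat). X i \<omega> = x) = 1" using mc by (simp add: markov_chain_def)
  then show ?case using x by (intro exI[of _ 0] exI[of _ "\<lambda>_. x"]) simp
next
  case (step y z)
  then obtain n s where s: "\<forall>i\<le>n. s i \<in> V" "s n = y" "0 < \<P>(\<omega> in M. \<forall>i\<le>n. X i \<omega> = s i)"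
    by blast
  define t where "t = s(Suc n := z)"
  have t: "\<forall>i\<le>Suc n. t i \<in> V" using s(1) step.hyps by (auto simp: t_def le_Suc_eq)
  then have "\<P>(\<omega> in M. \<forall>i\<le>Suc n. X i \<omega> = t i) = \<P>(\<omega> in M. \<forall>i\<le>n. X i \<omega> = t i) * P (t n) (t (Suc n))"
    using mc unfolding markov_chain_def by blast
  also have "\<dots> = \<P>(\<omega> in M. \<forall>i\<le>n. X i \<omega> = s i) * P y z"
    using s(2) by (simp add: t_def cong: conj_cong)
  also have "\<dots> > 0" using s step.hyps by simp
  finally show ?case using t by (intro exI[of _ "Suc n"] exI[of _ t]) (simp add: t_def)
qed

text \<open>With positive probability the chain follows some history from \<open>x\<close> to
  \<open>y\<close>; almost surely it then stays in \<open>D\<close> and misses \<open>x\<close>. If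
  it returned infinitely often almost surely, that history would be null.\<close>

lemma not_infinitely_often_if_escape:
  assumes mc: "markov_chain M X V P x" and V: "countable V" and x: "x \<in> V"
    and path: "(\<lambda>u v. v \<in> V \<and> 0 < P u v)\<^sup>*\<^sup>* x y"
    and D: "y \<in> D" "x \<notin> D"
    and closed: "\<And>u v. u \<in> D \<Longrightarrow> v \<in> V \<Longrightarrow> P u v \<noteq> 0 \<Longrightarrow> v \<in> D"
  shows "\<P>(\<omega> in M. \<exists>\<^sub>\<infinity>n. X n \<omega> = x) \<noteq> 1"
proof
  interpret prob_space M using mc by (simp add: markov_chain_def)
  note [measurable] = pred_markov_chain[OF mc]
  have XV: "X n \<omega> \<in> V" if "\<omega> \<in> space M" for n \<omega>
    using measurable_space[of "X n" M "count_space V" \<omega>] mc that by (simp add: markov_chain_def)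
  assume "\<P>(\<omega> in M. \<exists>\<^sub>\<infinity>n. X n \<omega> = x) = 1"
  then have io: "AE \<omega> in M. \<exists>\<^sub>\<infinity>n. X n \<omega> = x"
    by (subst (asm) prob_eq_1) (auto simp: INFM_nat)
  obtain n s where s: "s n = y" "0 < \<P>(\<omega> in M. \<forall>i\<le>n. X i \<omega> = s i)"
    using markov_chain_cylinder_pos[OF mc x path] by blast
  have "AE \<omega> in M. \<not> (\<forall>i\<le>n. X i \<omega> = s i)"
    using io markov_chain_AE_steps[OF mc V] AE_space
  proof eventually_elim
    case (elim \<omega>)
    show ?case
    proof
      assume *: "\<forall>i\<le>n. X i \<omega> = s i"
      have "X (n + k) \<omega> \<in> D" for k
      proof (induction k)
        case 0
        then show ?case using * s(1) D by auto
      next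
        case (Suc k)
        then show ?case using closed[OF Suc] XV[OF elim(3)] elim(2) by simp
      qed
      then have "X m \<omega> \<noteq> x" if "m > n" for m
        using that D by (metis less_imp_add_positive)
      then show False using elim(1) unfolding INFM_nat by blast
    qed
  qed
  then have "\<P>(\<omega> in M. \<forall>i\<le>n. X i \<omega> = s i) = 0"
    by (subst prob_eq_0) auto
  then show False using s(2) by simp
qed

text \<open>For a stochastic \<open>P\<close> this is the probability that the chain started at
  \<open>y\<close> is in \<open>D\<close> at times 1 to \<open>m\<close>, computed by conditioning
  on the first step. The start \<open>y\<close> need not lie in \<open>D\<close>.\<close>

primrec stay_prob :: "('v \<Rightarrow> 'v \<Rightarrow> real) \<Rightarrow> 'v set \<Rightarrow> nat \<Rightarrow> 'v \<Rightarrow> real" where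
  "stay_prob P D 0 y = 1"
| "stay_prob P D (Suc m) y = (\<Sum>z\<in>D. P y z * stay_prob P D m z)"

text \<open>The history is arbitrary so that the induction can absorb the next state
  \<open>z\<close> into it, with \<open>m\<close> steps left to go. A union bound over
  \<open>z\<close> is enough, as only upper estimates are needed.\<close>

lemma stay_prob_bound:
  assumes mc: "markov_chain M X V P x" and D: "finite D" "D \<subseteq> V"
    and s: "\<forall>i\<le>n. s i \<in> V"
  shows "\<P>(\<omega> in M. (\<forall>i\<le>n. X i \<omega> = s i) \<and> (\<forall>j. n < j \<and> j \<le> n + m \<longrightarrow> X j \<omega> \<in> D)) \<le>
    \<P>(\<omega> in M. \<forall>i\<le>n. X i \<omega> = s i) * stay_prob P D m (s n)"
  using s
proof (induction m arbitrary: n s)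
  case 0
  then show ?case by (simp add: leD cong: conj_cong)
next
  case (Suc m)
  interpret prob_space M using mc by (simp add: markov_chain_def)
  note [measurable] = pred_markov_chain[OF mc]
  define E where "E = (\<lambda>n s m. {\<omega> \<in> space M. (\<forall>i\<le>n. X i \<omega> = s i) \<and>
    (\<forall>j. n < j \<and> j \<le> n + m \<longrightarrow> X j \<omega> \<in> D)})"
  define t where "t = (\<lambda>z. s(Suc n := z))"
  have E_sets: "E n s m \<in> sets M" for n s m unfolding E_def by measurable
  have t: "\<forall>i\<le>Suc n. t z i \<in> V" if "z \<in> D" for z
    using Suc.prems that D(2) by (auto simp: t_def le_Suc_eq)
  have "E n s (Suc m) \<subseteq> (\<Union>z\<in>D. E (Suc n) (t z) m)"
  proof
    fix \<omega> assume "\<omega> \<in> E n s (Suc m)"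
    then have "X (Suc n) \<omega> \<in> D" "\<omega> \<in> E (Suc n) (t (X (Suc n) \<omega>)) m"
      by (auto simp: E_def t_def)
    then show "\<omega> \<in> (\<Union>z\<in>D. E (Suc n) (t z) m)" by blast
  qed
  then have "measure M (E n s (Suc m)) \<le> measure M (\<Union>z\<in>D. E (Suc n) (t z) m)"
    using E_sets D(1) by (intro finite_measure_mono) auto
  also have "\<dots> \<le> (\<Sum>z\<in>D. measure M (E (Suc n) (t z) m))"
    using E_sets D(1) by (intro measure_UNION_le) auto
  also have "\<dots> \<le> (\<Sum>z\<in>D. \<P>(\<omega> in M. \<forall>i\<le>Suc n. X i \<omega> = t z i) * stay_prob P D m (t z (Suc n)))"
    unfolding E_def by (intro sum_mono Suc.IH t)
  also have "\<dots> = (\<Sum>z\<in>D. \<P>(\<omega> in M. \<forall>i\<le>n. X i \<omega> = s i) * (P (s n) z * stay_prob P D m z))"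
  proof (intro sum.cong refl)
    fix z assume z: "z \<in> D"
    have "\<P>(\<omega> in M. \<forall>i\<le>Suc n. X i \<omega> = t z i) =
        \<P>(\<omega> in M. \<forall>i\<le>n. X i \<omega> = t z i) * P (t z n) (t z (Suc n))"
      using mc t[OF z] unfolding markov_chain_def by blast
    also have "\<dots> = \<P>(\<omega> in M. \<forall>i\<le>n. X i \<omega> = s i) * P (s n) z"
      by (simp add: t_def cong: conj_cong)
    finally show "\<P>(\<omega> in M. \<forall>i\<le>Suc n. X i \<omega> = t z i) * stay_prob P D m (t z (Suc n)) =
      \<P>(\<omega> in M. \<forall>i\<le>n. X i \<omega> = s i) * (P (s n) z * stay_prob P D m z)"
      by (simp add: t_def)
  qed
  finally show ?case by (simp add: E_def sum_distrib_left)
qed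

text \<open>
  The limit of the decreasing sequence is harmonic on C for the chain killed on entering x.
  By the maximum principle the set where it is maximal is closed under transitions, so a positive
  maximum would propagate to x.
\<close>

lemma stay_prob_tendsto_0:
  assumes C: "finite C" "x \<in> C"
    and nonneg: "\<And>y z. y \<in> C \<Longrightarrow> z \<in> C \<Longrightarrow> 0 \<le> P y z"
    and stoch: "\<And>y. y \<in> C \<Longrightarrow> (\<Sum>z\<in>C. P y z) = 1"
    and reach: "\<And>y. y \<in> C \<Longrightarrow> (\<lambda>u v. v \<in> C \<and> 0 < P u v)\<^sup>*\<^sup>* y x"
    and y: "y \<in> C"
  shows "(\<lambda>m. stay_prob P (C - {x}) m y) \<longlonglongrightarrow> 0"
proof -
  define D where "D = C - {x}"
  define q where "q = stay_prob P D"
  have D: "finite D" "D \<subseteq> C" "x \<notin> D" "C = insert x D" using C by (auto simp: D_def)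
  have q0: "q 0 y = 1" and qS: "q (Suc m) y = (\<Sum>z\<in>D. P y z * q m z)" for m y
    by (simp_all add: q_def)
  have q_nonneg: "0 \<le> q m y" if "y \<in> C" for m y
    using that
  proof (induction m arbitrary: y)
    case (Suc m)
    then show ?case unfolding qS using nonneg D by (intro sum_nonneg mult_nonneg_nonneg) auto
  qed (simp add: q0)
  have q_dec: "q (Suc m) y \<le> q m y" if "y \<in> C" for m y
    using that
  proof (induction m arbitrary: y)
    case 0
    have "(\<Sum>z\<in>D. P y z) \<le> (\<Sum>z\<in>C. P y z)"
      using D C nonneg[OF 0] by (intro sum_mono2) auto
    then show ?case using stoch[OF 0] by (simp add: q0 qS)
  next
    case (Suc m)
    have "(\<Sum>z\<in>D. P y z * q (Suc m) z) \<le> (\<Sum>z\<in>D. P y z * q m z)"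
      using Suc D(2) nonneg by (intro sum_mono mult_left_mono) (simp_all add: subset_iff)
    then show ?case by (simp only: qS)
  qed
  have "\<exists>l. (\<lambda>m. q m y) \<longlonglongrightarrow> l" if "y \<in> C" for y
  proof -
    have "decseq (\<lambda>m. q m y)" using q_dec[OF that] by (auto intro: decseq_SucI)
    then show ?thesis using q_nonneg[OF that] by (rule_tac decseq_convergent[of "\<lambda>m. q m y" 0]) blast+
  qed
  then obtain h where h: "(\<lambda>m. q m y) \<longlonglongrightarrow> h y" if "y \<in> C" for y
    by metis
  have h_nonneg: "0 \<le> h y" if "y \<in> C" for y
    using LIMSEQ_le_const[OF h[OF that]] q_nonneg[OF that] by blast
  have harm: "h y = (\<Sum>z\<in>D. P y z * h z)" if "y \<in> C" for y
  proof -
    have "(\<lambda>m. q (Suc m) y) \<longlonglongrightarrow> (\<Sum>z\<in>D. P y z * h z)"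
      unfolding qS using D by (intro tendsto_sum tendsto_mult tendsto_const h) auto
    moreover have "(\<lambda>m. q (Suc m) y) \<longlonglongrightarrow> h y" using h[OF that] by (rule LIMSEQ_Suc)
    ultimately show ?thesis using LIMSEQ_unique by blast
  qed
  define S where "S = Max (h ` C)"
  have fin: "finite (h ` C)" "h ` C \<noteq> {}" using C by auto
  have le_S: "h z \<le> S" if "z \<in> C" for z
    unfolding S_def using fin that by (intro Max_ge) auto
  have S_nonneg: "0 \<le> S" using le_S[OF y] h_nonneg[OF y] by simp
  have "S = 0"
  proof (rule ccontr)
    assume "S \<noteq> 0"
    then have S_pos: "0 < S" using S_nonneg by simp
    obtain y0 where y0: "y0 \<in> C" "h y0 = S"
      using Max_in[OF fin] unfolding S_def by auto
    have max_step: "z \<noteq> x \<and> h z = S" if u: "u \<in> C" "h u = S" and z: "z \<in> C" "0 < P u z" for u z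
    proof -
      \<comment> \<open>\<open>?g\<close> is \<open>h\<close> killed at \<open>x\<close>, which
        turns harmonicity into an average over all of \<open>C\<close>. The nonnegative function
        \<open>S - ?g\<close> has average 0, so it vanishes wherever the weight is positive;
        \<open>S > 0\<close> then rules out \<open>z = x\<close>.\<close>
      let ?g = "\<lambda>z. if z = x then 0 else h z"
      have "(\<Sum>z\<in>C. P u z * (S - ?g z)) = (\<Sum>z\<in>C. P u z) * S - (\<Sum>z\<in>C. P u z * ?g z)"
        by (simp only: right_diff_distrib sum_subtractf sum_distrib_right)
      moreover have "(\<Sum>z\<in>C. P u z * ?g z) = (\<Sum>z\<in>D. P u z * h z)"
        using D by (subst D(4), subst sum.insert) (auto intro!: sum.cong)
      ultimately have "(\<Sum>z\<in>C. P u z * (S - ?g z)) = 0"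
        using harm[OF u(1)] stoch[OF u(1)] u(2) by simp
      moreover have "\<forall>z\<in>C. 0 \<le> P u z * (S - ?g z)"
        using nonneg u(1) le_S S_nonneg by auto
      ultimately have "P u z * (S - ?g z) = 0"
        using sum_nonneg_eq_0_iff[OF C(1)] z(1) by (metis (no_types, lifting))
      then have "S = ?g z" using z(2) by simp
      then show ?thesis using S_pos by (auto split: if_splits)
    qed
    have path: "v \<in> C \<and> h v = S \<and> v \<noteq> x"
      if "(\<lambda>u v. v \<in> C \<and> 0 < P u v)\<^sup>*\<^sup>* u v" "u \<in> C" "h u = S" "u \<noteq> x" for u v
      using that by (induction rule: rtranclp_induct) (use max_step in auto)
    \<comment> \<open>The maximum may sit at \<open>x\<close> itself, since killing affects only
      visits after the start. One positive step leads to a maximal point other than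
      \<open>x\<close>, where \<open>path\<close> applies.\<close>
    obtain z where z: "z \<in> C" "0 < P y0 z"
    proof (rule ccontr)
      assume "\<not> thesis"
      then have "(\<Sum>z\<in>C. P y0 z) \<le> 0" using that by (intro sum_nonpos) (meson not_le)
      then show False using stoch[OF y0(1)] by simp
    qed
    then have "z \<noteq> x" "h z = S" using max_step[OF y0 z] by auto
    then show False using path[OF reach[OF z(1)] z(1)] by simp
  qed
  then have "h y = 0" using le_S[OF y] h_nonneg[OF y] by simp
  then show ?thesis using h[OF y] by (simp add: q_def D_def)
qed

text \<open>A trajectory with finitely many visits to \<open>x\<close> stays in
  \<open>C - {x}\<close> after some time \<open>n\<close>. For each of the countably many histories
  up to \<open>n\<close>, the probability of this is at most a multiple of \<open>stay_prob\<close>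
  for every \<open>m\<close>, hence 0.\<close>

lemma finite_irreducible_infinitely_often:
  assumes mc: "markov_chain M X V P x" and V: "countable V"
    and C: "finite C" "x \<in> C" "C \<subseteq> V"
    and nonneg: "\<And>y z. y \<in> C \<Longrightarrow> z \<in> C \<Longrightarrow> 0 \<le> P y z"
    and stoch: "\<And>y. y \<in> C \<Longrightarrow> (\<Sum>z\<in>C. P y z) = 1"
    and closed: "\<And>y z. y \<in> C \<Longrightarrow> z \<in> V \<Longrightarrow> P y z \<noteq> 0 \<Longrightarrow> z \<in> C"
    and reach: "\<And>y. y \<in> C \<Longrightarrow> (\<lambda>u v. v \<in> C \<and> 0 < P u v)\<^sup>*\<^sup>* y x"
  shows "\<P>(\<omega> in M. \<exists>\<^sub>\<infinity>n. X n \<omega> = x) = 1"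
proof -
  interpret prob_space M using mc by (simp add: markov_chain_def)
  note [measurable] = pred_markov_chain[OF mc]
  have XV: "X n \<omega> \<in> V" if "\<omega> \<in> space M" for n \<omega>
    using measurable_space[of "X n" M "count_space V" \<omega>] mc that by (simp add: markov_chain_def)
  define D where "D = C - {x}"
  define A where "A = (\<lambda>n xs \<omega>. (\<forall>i\<le>n. X i \<omega> = xs ! i) \<and> (\<forall>j>n. X j \<omega> \<in> D))"
  have null: "AE \<omega> in M. \<not> A n xs \<omega>" if xs: "xs \<in> lists C" "length xs = Suc n" for n xs
  proof -
    have xsC: "xs ! i \<in> C" if "i \<le> n" for i using xs that by (auto simp: lists_eq_set)
    have bound: "\<P>(\<omega> in M. A n xs \<omega>) \<le>
        \<P>(\<omega> in M. \<forall>i\<le>n. X i \<omega> = xs ! i) * stay_prob P D m (xs ! n)" for m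
    proof -
      have "\<P>(\<omega> in M. A n xs \<omega>) \<le> \<P>(\<omega> in M. (\<forall>i\<le>n. X i \<omega> = xs ! i) \<and>
          (\<forall>j. n < j \<and> j \<le> n + m \<longrightarrow> X j \<omega> \<in> D))"
        by (intro finite_measure_mono) (auto simp: A_def)
      also have "\<dots> \<le> \<P>(\<omega> in M. \<forall>i\<le>n. X i \<omega> = xs ! i) * stay_prob P D m (xs ! n)"
        using stay_prob_bound[OF mc, of D n "\<lambda>i. xs ! i" m] C xsC by (auto simp: D_def)
      finally show ?thesis .
    qed
    have "(\<lambda>m. stay_prob P D m (xs ! n)) \<longlonglongrightarrow> 0"
      unfolding D_def using C nonneg stoch reach xsC by (intro stay_prob_tendsto_0) auto
    then have "(\<lambda>m. \<P>(\<omega> in M. \<forall>i\<le>n. X i \<omega> = xs ! i) * stay_prob P D m (xs ! n)) \<longlonglongrightarrow> 0"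
      by (rule tendsto_mult_right_zero)
    then have "\<P>(\<omega> in M. A n xs \<omega>) \<le> 0"
      by (rule LIMSEQ_le_const) (use bound in blast)
    then have "\<P>(\<omega> in M. A n xs \<omega>) = 0" by (simp add: measure_le_0_iff)
    then show ?thesis by (subst (asm) prob_eq_0) (auto simp: A_def)
  qed
  have "AE \<omega> in M. \<forall>xs\<in>lists C. \<forall>n. length xs = Suc n \<longrightarrow> \<not> A n xs \<omega>"
    unfolding AE_ball_countable[OF countable_lists[OF countable_finite[OF C(1)]]] AE_all_countable
    using null by auto
  moreover have "AE \<omega> in M. X 0 \<omega> = x"
  proof -
    have "\<P>(\<omega> in M. X 0 \<omega> = x) = 1" using mc by (simp add: markov_chain_def)
    then show ?thesis by (subst (asm) prob_eq_1) auto
  qed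
  ultimately have "AE \<omega> in M. \<exists>\<^sub>\<infinity>n. X n \<omega> = x"
    using markov_chain_AE_steps[OF mc V] AE_space
  proof eventually_elim
    case (elim \<omega>)
    have inC: "X n \<omega> \<in> C" for n
    proof (induction n)
      case (Suc n)
      then show ?case using closed[OF Suc] XV[OF elim(4)] elim(3) by simp
    qed (use elim(2) C in simp)
    show ?case unfolding INFM_nat
    proof (rule ccontr)
      assume "\<not> (\<forall>m. \<exists>n>m. X n \<omega> = x)"
      then obtain n where n: "\<forall>j>n. X j \<omega> \<noteq> x" by blast
      define xs where "xs = map (\<lambda>i. X i \<omega>) [0..<Suc n]"
      have "xs ! i = X i \<omega>" if "i \<le> n" for i
        unfolding xs_def using that by (subst nth_map) (auto simp del: upt_Suc)
      then have "A n xs \<omega>" using n inC by (simp add: A_def D_def)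
      moreover have "xs \<in> lists C" "length xs = Suc n" using inC by (auto simp: xs_def)
      ultimately show False using elim(1) by blast
    qed
  qed
  then show ?thesis by (subst prob_eq_1) (auto simp: INFM_nat)
qed

section \<open>Components of weighted graphs\<close>

text \<open>\<open>x \<in> U\<close> is stated separately because the relation constrains only
  targets of steps. \<open>Q\<close> is instantiated once for components and once for
  essentiality.\<close>

lemma path_in_iff_rtranclp:
  "(\<exists>xs. path_in U b x xs y \<and> (\<forall>i. Suc i < length xs \<longrightarrow> Q (xs ! i) (xs ! Suc i))) \<longleftrightarrow>
    x \<in> U \<and> (\<lambda>u v. v \<in> U \<and> 0 < b u v \<and> Q u v)\<^sup>*\<^sup>* x y"
proof
  assume "\<exists>xs. path_in U b x xs y \<and> (\<forall>i. Suc i < length xs \<longrightarrow> Q (xs ! i) (xs ! Suc i))"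
  then obtain xs where xs: "xs \<noteq> []" "hd xs = x" "last xs = y" "set xs \<subseteq> U"
    "\<And>i. Suc i < length xs \<Longrightarrow> 0 < b (xs ! i) (xs ! Suc i) \<and> Q (xs ! i) (xs ! Suc i)"
    unfolding path_in_def by blast
  have "(\<lambda>u v. v \<in> U \<and> 0 < b u v \<and> Q u v)\<^sup>*\<^sup>* x (xs ! i)" if "i < length xs" for i
    using that
  proof (induction i)
    case 0
    then show ?case using xs(1,2) by (simp add: hd_conv_nth)
  next
    case (Suc i)
    then have "xs ! Suc i \<in> U" using xs(4) nth_mem by blast
    then show ?case using Suc xs(5)[of i] by (auto intro: rtranclp.rtrancl_into_rtrancl)
  qed
  from this[of "length xs - 1"] have "(\<lambda>u v. v \<in> U \<and> 0 < b u v \<and> Q u v)\<^sup>*\<^sup>* x y"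
    using xs(1,3) by (simp add: last_conv_nth)
  moreover have "x \<in> U" using xs(1,2,4) hd_in_set by blast
  ultimately show "x \<in> U \<and> (\<lambda>u v. v \<in> U \<and> 0 < b u v \<and> Q u v)\<^sup>*\<^sup>* x y" by blast
next
  assume *: "x \<in> U \<and> (\<lambda>u v. v \<in> U \<and> 0 < b u v \<and> Q u v)\<^sup>*\<^sup>* x y"
  then have "(\<lambda>u v. v \<in> U \<and> 0 < b u v \<and> Q u v)\<^sup>*\<^sup>* x y" ..
  then show "\<exists>xs. path_in U b x xs y \<and> (\<forall>i. Suc i < length xs \<longrightarrow> Q (xs ! i) (xs ! Suc i))"
  proof (induction rule: rtranclp_induct)
    case base
    show ?case using * by (intro exI[of _ "[x]"]) (simp add: path_in_def)
  next
    case (step y z)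
    then obtain xs where xs: "path_in U b x xs y"
      "\<And>i. Suc i < length xs \<Longrightarrow> Q (xs ! i) (xs ! Suc i)" by blast
    have last: "(xs @ [z]) ! i = y" if "Suc i = length xs" for i
      using xs(1) by (auto simp: path_in_def last_conv_nth nth_append simp flip: that)
    have "0 < b ((xs @ [z]) ! i) ((xs @ [z]) ! Suc i) \<and> Q ((xs @ [z]) ! i) ((xs @ [z]) ! Suc i)"
      if "Suc i < length (xs @ [z])" for i
    proof (cases "Suc i < length xs")
      case True
      then show ?thesis using xs by (simp add: path_in_def nth_append)
    next
      case False
      then have "Suc i = length xs" using that by simp
      then show ?thesis using last[of i] step.hyps by (metis nth_append_length)
    qed
    moreover have "hd (xs @ [z]) = x" "set (xs @ [z]) \<subseteq> U"
      using xs(1) step.hyps by (auto simp: path_in_def)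
    ultimately show ?case by (intro exI[of _ "xs @ [z]"]) (auto simp: path_in_def)
  qed
qed

text \<open>A one-vertex graph is excluded because its vertex has weight 0; division by 0 would then
  give a zero row if the vertex is in \<open>U\<close>, which is not stochastic.\<close>

locale network =
  fixes V U :: "'v set" and b :: "'v \<Rightarrow> 'v \<Rightarrow> 'k::linordered_field"
  assumes V: "countable V" "\<nexists>x. V = {x}"
    and graph: "weighted_graph V b" "connected_graph V b" "locally_finite_graph V b"
    and U: "U \<subseteq> V"
begin

abbreviation w where "w \<equiv> vweight V b"
abbreviation \<pi> where "\<pi> \<equiv> real_trans V U b"

text \<open>For \<open>u\<close> in \<open>U\<close> these are the transitions of positive
  probability that stay in \<open>U\<close>, see \<open>real_trans_pos_iff\<close>.\<close>

definition step where "step u v \<longleftrightarrow> v \<in> U \<and> b u v \<simeq> w u"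

text \<open>In contrast to \<open>step\<close>, the edge is compared with the fixed weight
  \<open>w x\<close>, not with the weight of its source. This makes the relation reversible inside
  \<open>U\<close> and dependent only on the class of \<open>w x\<close>.\<close>

definition link where "link x u v \<longleftrightarrow> v \<in> U \<and> w x \<simeq> b u v"

definition linked where
  "linked x y \<longleftrightarrow> (\<exists>xs. path_in U b x xs y \<and>
    (\<forall>i. Suc i < length xs \<longrightarrow> w x \<simeq> b (xs ! i) (xs ! Suc i) \<and> b (xs ! i) (xs ! Suc i) \<simeq> w y))"

lemma b_nonneg: "x \<in> V \<Longrightarrow> y \<in> V \<Longrightarrow> 0 \<le> b x y"
  and b_sym: "x \<in> V \<Longrightarrow> y \<in> V \<Longrightarrow> b x y = b y x"
  using graph(1) by (auto simp: weighted_graph_def)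

lemma finite_neighbors: "x \<in> V \<Longrightarrow> finite (neighbors V b x)"
  using graph(3) by (simp add: locally_finite_graph_def)

lemma edge_le_weight:
  assumes "x \<in> V" "y \<in> V"
  shows "b x y \<le> w x"
proof (cases "0 < b x y")
  case True
  then show ?thesis
    unfolding vweight_def using assms finite_neighbors
    by (intro member_le_sum) (auto simp: neighbors_def)
next
  case False
  then have "b x y \<le> 0" by simp
  also have "0 \<le> w x" unfolding vweight_def by (intro sum_nonneg) (auto simp: neighbors_def)
  finally show ?thesis .
qed

text \<open>Connectedness joins \<open>x\<close> to a second vertex, and the first edge of such a
  path is positive and at most \<open>w x\<close>.\<close>

lemma weight_pos:
  assumes x: "x \<in> V"
  shows "0 < w x"
proof -
  obtain y where y: "y \<in> V" "y \<noteq> x" using V(2) x by blast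
  obtain xs where xs: "path_in V b x xs y" using graph(2) x y by (auto simp: connected_graph_def)
  then have xs': "xs \<noteq> []" "xs ! 0 = x" by (auto simp: path_in_def hd_conv_nth)
  have "length xs \<noteq> 1"
    using xs y by (auto simp: path_in_def length_Suc_conv)
  then have len: "Suc 0 < length xs" using xs'(1) by (cases xs) auto
  then have "0 < b x (xs ! 1)" "xs ! 1 \<in> V"
    using xs xs' nth_mem[OF len] by (auto simp: path_in_def)
  then show ?thesis using edge_le_weight[OF x] by fastforce
qed

lemma trans_prob_bounds:
  assumes "x \<in> V" "y \<in> V"
  shows "0 \<le> trans_prob V b x y" "trans_prob V b x y \<le> 1"
  unfolding trans_prob_def using assms edge_le_weight weight_pos b_nonneg
  by (auto simp: less_imp_le)

lemma real_trans_nonneg: "u \<in> V \<Longrightarrow> v \<in> V \<Longrightarrow> 0 \<le> \<pi> u v"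
  unfolding real_trans_def using real_part_nonneg[OF trans_prob_bounds] by simp

text \<open>Since \<open>b u v\<close> never exceeds \<open>w u\<close>, comparability is only a
  matter of the lower bound, which is what a positive real part expresses.\<close>

lemma real_trans_pos_iff:
  assumes u: "u \<in> U" and v: "v \<in> V"
  shows "0 < \<pi> u v \<longleftrightarrow> b u v \<simeq> w u"
proof -
  have uV: "u \<in> V" using u U by blast
  note w = weight_pos[OF uV]
  have "0 < \<pi> u v \<longleftrightarrow> (\<exists>c::rat. 0 < c \<and> of_rat c \<le> b u v / w u)"
    using real_part_pos_iff[OF trans_prob_bounds[OF uV v]] u
    by (simp add: real_trans_def trans_prob_def)
  also have "\<dots> \<longleftrightarrow> dominated (w u) (b u v)"
    unfolding dominated_def using w by (simp add: pos_le_divide_eq)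
  also have "\<dots> \<longleftrightarrow> b u v \<simeq> w u"
  proof
    assume *: "dominated (w u) (b u v)"
    then obtain c :: rat where "0 < c" "of_rat c * w u \<le> b u v" unfolding dominated_def by blast
    moreover from this have "0 < of_rat c * w u" using w by simp
    ultimately have "0 < b u v" by simp
    then show "b u v \<simeq> w u"
      using * w dominated_if_le[OF edge_le_weight[OF uV v]] by (simp add: simeq_iff_dominated)
  qed (simp add: simeq_iff_dominated)
  finally show ?thesis .
qed

text \<open>The probabilities sum to exactly 1 in the ordered field, and closeness is additive over
  the finitely many neighbors.\<close>

lemma sum_real_trans:
  assumes u: "u \<in> U"
  shows "(\<Sum>v\<in>neighbors V b u. \<pi> u v) = 1"
proof -
  have uV: "u \<in> V" using u U by blast
  have "infinitely_close (\<Sum>v\<in>neighbors V b u. trans_prob V b u v) (\<Sum>v\<in>neighbors V b u. \<pi> u v)"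
    using infinitely_close_real_part[OF trans_prob_bounds[OF uV]] u
    by (intro infinitely_close_sum) (auto simp: real_trans_def neighbors_def)
  moreover have "(\<Sum>v\<in>neighbors V b u. trans_prob V b u v) = w u / w u"
    unfolding trans_prob_def sum_divide_distrib[symmetric] by (simp add: vweight_def)
  ultimately have "infinitely_close (1 :: 'k) (\<Sum>v\<in>neighbors V b u. \<pi> u v)"
    using weight_pos[OF uV] by simp
  then show ?thesis
    using infinitely_close_unique infinitely_close_of_rat[of 1, where 'a='k] by simp
qed

lemma real_trans_not_neighbor:
  assumes "u \<in> U" "v \<in> V" "v \<notin> neighbors V b u"
  shows "\<pi> u v = 0"
  using real_trans_pos_iff[OF assms(1,2)] real_trans_nonneg[of u v] assms U
  by (auto simp: neighbors_def simeq_iff_dominated)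

lemma real_trans_stochastic:
  assumes u: "u \<in> V"
  shows "(\<integral>\<^sup>+v. ennreal (\<pi> u v) \<partial>count_space V) = 1"
proof (cases "u \<in> U")
  case True
  have "(\<integral>\<^sup>+v. ennreal (\<pi> u v) \<partial>count_space V) = (\<Sum>v\<in>neighbors V b u. ennreal (\<pi> u v))"
    using u finite_neighbors[OF u] real_trans_not_neighbor[OF True]
    by (intro nn_integral_count_space') (auto simp: neighbors_def)
  also have "\<dots> = ennreal (\<Sum>v\<in>neighbors V b u. \<pi> u v)"
    using real_trans_nonneg[OF u] by (intro sum_ennreal) (auto simp: neighbors_def)
  finally show ?thesis by (simp add: sum_real_trans[OF True])
next
  case False
  then have "(\<integral>\<^sup>+v. ennreal (\<pi> u v) \<partial>count_space V) = (\<Sum>v\<in>{u}. ennreal (\<pi> u v))"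
    using u by (intro nn_integral_count_space') (auto simp: real_trans_def)
  then show ?thesis using False by (simp add: real_trans_def)
qed

text \<open>The path without edges imposes no condition, hence the case \<open>x = y\<close>.
  Otherwise any edge of the path mediates \<open>w x \<simeq> w y\<close>, and this in turn makes
  the comparison of edges with \<open>w y\<close> follow from that with \<open>w x\<close>.\<close>

lemma linked_iff: "linked x y \<longleftrightarrow> x \<in> U \<and> (x = y \<or> w x \<simeq> w y \<and> (link x)\<^sup>*\<^sup>* x y)"
proof -
  let ?R = "\<lambda>u v. v \<in> U \<and> 0 < b u v \<and> w x \<simeq> b u v \<and> b u v \<simeq> w y"
  have "linked x y \<longleftrightarrow> x \<in> U \<and> ?R\<^sup>*\<^sup>* x y"
    unfolding linked_def
    by (rule path_in_iff_rtranclp[where Q = "\<lambda>u v. w x \<simeq> b u v \<and> b u v \<simeq> w y"])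
  moreover have "w x \<simeq> w y \<and> (link x)\<^sup>*\<^sup>* x y" if path: "?R\<^sup>*\<^sup>* x y" and neq: "x \<noteq> y"
  proof
    obtain v where "?R x v" using converse_rtranclpE[OF path] neq by metis
    then show "w x \<simeq> w y" using simeq_trans by blast
    have "?R \<le> link x" by (auto simp: link_def)
    from rtranclp_mono[OF this] show "(link x)\<^sup>*\<^sup>* x y" using path by (rule predicate2D)
  qed
  moreover have "?R\<^sup>*\<^sup>* x y" if "w x \<simeq> w y" "(link x)\<^sup>*\<^sup>* x y"
  proof -
    have "0 < b u v \<and> b u v \<simeq> w y" if "w x \<simeq> b u v" for u v
      using simeq_trans[OF simeq_sym[OF that] \<open>w x \<simeq> w y\<close>] by (simp add: simeq_def)
    then have "link x \<le> ?R" by (auto simp: link_def)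
    from rtranclp_mono[OF this] show ?thesis using that(2) by (rule predicate2D)
  qed
  ultimately show ?thesis by blast
qed

lemma linked_refl: "x \<in> U \<Longrightarrow> linked x x"
  by (simp add: linked_iff)

lemma linked_in_U:
  assumes "linked x y"
  shows "y \<in> U"
proof -
  obtain xs where "path_in U b x xs y" using assms by (auto simp: linked_def)
  then show ?thesis using last_in_set[of xs] by (auto simp: path_in_def)
qed

lemma linked_weight: "linked x y \<Longrightarrow> w x \<simeq> w y"
  using weight_pos U by (auto simp: linked_iff intro: simeq_refl)

lemma link_cong:
  assumes "w x \<simeq> w y"
  shows "link x = link y"
  using simeq_trans[OF assms] simeq_trans[OF simeq_sym[OF assms]]
  unfolding link_def fun_eq_iff by blast

lemma linked_sym:
  assumes "linked x y"
  shows "linked y x"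
proof (cases "x = y")
  case False
  then have x: "x \<in> U" "w x \<simeq> w y" "(link x)\<^sup>*\<^sup>* x y" using assms by (auto simp: linked_iff)
  from x(3) have "y \<in> U \<and> (link x)\<^sup>*\<^sup>* y x"
  proof (induction rule: rtranclp_induct)
    case (step u v)
    then have u: "u \<in> U" and v: "v \<in> U" and "w x \<simeq> b u v" by (auto simp: link_def)
    moreover have "b u v = b v u" using u v U by (intro b_sym) auto
    ultimately have "link x v u" by (simp add: link_def)
    then show ?case using v step.IH by (simp add: converse_rtranclp_into_rtranclp)
  qed (use x in simp)
  then show ?thesis using simeq_sym[OF x(2)] link_cong[OF x(2)] by (simp add: linked_iff)
qed (use assms in simp)

lemma linked_trans:
  assumes "linked x y" "linked y z"
  shows "linked x z"
proof (cases "x = y \<or> y = z")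
  case False
  then have "x \<in> U" "w x \<simeq> w y" "(link x)\<^sup>*\<^sup>* x y" "w y \<simeq> w z" "(link y)\<^sup>*\<^sup>* y z"
    using assms by (auto simp: linked_iff)
  moreover from this have "link y = link x" using link_cong by metis
  ultimately show ?thesis
    unfolding linked_iff using simeq_trans rtranclp_trans[of "link x" x y z] by metis
qed (use assms in auto)

lemma strongly_connected_iff:
  "strongly_connected V U b C \<longleftrightarrow> C \<subseteq> U \<and> (\<forall>x\<in>C. \<forall>y\<in>C. linked x y)"
  unfolding strongly_connected_def linked_def ..

lemma strongly_connected_linked: "strongly_connected V U b {y. linked x y}"
  unfolding strongly_connected_iff
proof (intro conjI ballI)
  fix u v assume "u \<in> {y. linked x y}" "v \<in> {y. linked x y}"
  then show "linked u v" using linked_trans[OF linked_sym[of x u]] by simp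
qed (use linked_in_U in blast)

lemma strong_component_linked:
  assumes "x \<in> U"
  shows "strong_component V U b {y. linked x y}"
  unfolding strong_component_def
proof (intro conjI allI impI strongly_connected_linked)
  fix D assume D: "strongly_connected V U b D \<and> {y. linked x y} \<subseteq> D"
  then have "x \<in> D" using linked_refl[OF assms] by blast
  then have "\<forall>y\<in>D. linked x y" using D unfolding strongly_connected_iff by blast
  then show "D = {y. linked x y}" using D by blast
qed

text \<open>\<open>linked\<close> is an equivalence relation on \<open>U\<close>, so a maximal
  strongly connected set is the class of each of its members.\<close>

lemma strong_component_eq_linked:
  assumes "strong_component V U b C" "x \<in> C"
  shows "C = {y. linked x y}"
proof -
  have "\<forall>y\<in>C. linked x y"
    using assms unfolding strong_component_def strongly_connected_iff by blast
  then have "C \<subseteq> {y. linked x y}" by blast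
  then show ?thesis
    using assms(1) strongly_connected_linked[of x] unfolding strong_component_def by blast
qed

lemma essential_component_iff:
  "essential_component V U b C \<longleftrightarrow>
    strong_component V U b C \<and> (\<forall>x\<in>C. \<forall>y. step\<^sup>*\<^sup>* x y \<longrightarrow> w x \<simeq> w y)"
proof -
  have step: "step = (\<lambda>u v. v \<in> U \<and> 0 < b u v \<and> b u v \<simeq> w u)"
    by (auto simp: step_def fun_eq_iff simeq_iff_dominated)
  have path: "(\<exists>xs. path_in U b x xs y \<and> (\<forall>i. Suc i < length xs \<longrightarrow> b (xs ! i) (xs ! Suc i) \<simeq> w (xs ! i)))
      \<longleftrightarrow> x \<in> U \<and> step\<^sup>*\<^sup>* x y" for x y
    unfolding step by (rule path_in_iff_rtranclp[where Q = "\<lambda>u v. b u v \<simeq> w u"])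
  have "x \<in> U" if "strong_component V U b C" "x \<in> C" for x
    using that by (auto simp: strong_component_def strongly_connected_def)
  then show ?thesis
    unfolding essential_component_def using path by blast
qed

lemma steps_weight:
  assumes "step\<^sup>*\<^sup>* x y" "x \<in> U"
  shows "y \<in> U \<and> dominated (w x) (w y)"
  using assms(1)
proof (induction rule: rtranclp_induct)
  case base
  then show ?case using assms(2) by (simp add: dominated_if_le)
next
  case (step u v)
  then have uv: "u \<in> V" "v \<in> V" "v \<in> U" "b u v \<simeq> w u" using U by (auto simp: step_def)
  then have "dominated (w u) (b u v)" by (simp add: simeq_iff_dominated)
  moreover have "dominated (b u v) (w v)"
    using dominated_if_le[OF edge_le_weight[of v u]] uv by (simp add: b_sym)
  ultimately show ?case using step uv(3) dominated_trans by blast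
qed

text \<open>As long as \<open>u\<close> has been reached by steps, \<open>const\<close> gives
  \<open>w u \<simeq> w x\<close>, so comparing an edge with \<open>w x\<close> is the same as
  comparing it with its source.\<close>

lemma links_imp_steps:
  assumes x: "x \<in> U" and const: "\<And>v. step\<^sup>*\<^sup>* x v \<Longrightarrow> w x \<simeq> w v"
    and "(link x)\<^sup>*\<^sup>* x z"
  shows "step\<^sup>*\<^sup>* x z"
  using assms(3)
proof (induction rule: rtranclp_induct)
  case (step u v)
  then have "w u \<simeq> b u v"
    using simeq_trans[OF simeq_sym[OF const[of u]]] by (simp add: link_def)
  then have "step u v" using step simeq_sym[of "w u"] by (simp add: step_def link_def)
  then show ?case using step by simp
qed simp

text \<open>
  Weights do not decrease along transitions within U up to rational factors, so a chain that has
  climbed to infinitely larger weights, or has left U, never comes back.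
\<close>

lemma recurrent_steps_weight:
  assumes rec: "recurrent V U b x" and path: "step\<^sup>*\<^sup>* x y"
  shows "w x \<simeq> w y"
proof (rule ccontr)
  assume neq: "\<not> w x \<simeq> w y"
  have x: "x \<in> U" "x \<in> V" using rec U by (auto simp: recurrent_def)
  have y: "y \<in> U" "y \<in> V" "dominated (w x) (w y)" using steps_weight[OF path x(1)] U by auto
  then have ndom: "\<not> dominated (w y) (w x)"
    using neq weight_pos x by (auto simp: simeq_iff_dominated)
  obtain M :: "(nat \<Rightarrow> 'v) measure" and X where mc: "markov_chain M X V \<pi> x"
    using markov_chain_exists[where P = \<pi>, OF V(1) x(2) real_trans_nonneg real_trans_stochastic] by blast
  \<comment> \<open>Vertices outside \<open>U\<close> are absorbing, so they join the infinitely
    heavier ones in a closed set that contains \<open>y\<close> but not \<open>x\<close>.\<close>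
  define D where "D = {v \<in> V. v \<notin> U \<or> \<not> dominated (w v) (w x)}"
  have pos_path: "(\<lambda>u v. v \<in> V \<and> 0 < \<pi> u v)\<^sup>*\<^sup>* x y"
    using path
  proof (induction rule: rtranclp_induct)
    case (step u v)
    have "u \<in> U" using steps_weight[OF step(1) x(1)] by simp
    then have "v \<in> V \<and> 0 < \<pi> u v"
      using step(2) U real_trans_pos_iff[of u v] by (auto simp: step_def)
    then show ?case using step.IH by (auto intro: rtranclp.rtrancl_into_rtrancl)
  qed simp
  have closed: "v \<in> D" if u: "u \<in> D" and v: "v \<in> V" and P: "\<pi> u v \<noteq> 0" for u v
  proof (cases "u \<in> U \<and> v \<in> U")
    case True
    then have "0 < \<pi> u v" using P real_trans_nonneg[of u v] U v by force
    then have "step u v" using True real_trans_pos_iff v by (simp add: step_def)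
    then have "dominated (w u) (w v)" using steps_weight[of u v] True by blast
    then show ?thesis using u v True dominated_trans[of "w u" "w v" "w x"] by (auto simp: D_def)
  next
    \<comment> \<open>If \<open>u\<close> is outside \<open>U\<close>, the chain stays put and
      \<open>v = u\<close>; if \<open>v\<close> is outside \<open>U\<close>, it belongs to
      \<open>D\<close> by definition.\<close>
    case False
    then show ?thesis using u v P by (auto simp: D_def real_trans_def split: if_splits)
  qed
  have "\<P>(\<omega> in M. \<exists>\<^sub>\<infinity>n. X n \<omega> = x) \<noteq> 1"
  proof (rule not_infinitely_often_if_escape[OF mc V(1) x(2) pos_path _ _ closed])
    show "y \<in> D" using y ndom by (simp add: D_def)
    show "x \<notin> D" using x by (simp add: D_def dominated_if_le)
  qed
  then show False using rec mc unfolding recurrent_def by blast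
qed

lemma recurrent_imp_essential:
  assumes rec: "recurrent V U b x"
  shows "\<exists>C. essential_component V U b C \<and> x \<in> C"
proof (intro exI conjI)
  have x: "x \<in> U" using rec by (simp add: recurrent_def)
  note const = recurrent_steps_weight[OF rec]
  show "x \<in> {y. linked x y}" using linked_refl[OF x] by simp
  show "essential_component V U b {y. linked x y}"
    unfolding essential_component_iff
  proof (intro conjI ballI allI impI)
    show "strong_component V U b {y. linked x y}" by (rule strong_component_linked[OF x])
    fix z y assume "z \<in> {y. linked x y}" and zy: "step\<^sup>*\<^sup>* z y"
    then have z: "linked x z" by simp
    \<comment> \<open>Essentiality concerns every \<open>z\<close> of the class, but recurrence is
      known only for \<open>x\<close>. Reaching \<open>z\<close> from \<open>x\<close> by steps lets
      paths from \<open>z\<close> be continued from \<open>x\<close>.\<close>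
    then have "step\<^sup>*\<^sup>* x z" using links_imp_steps[OF x const] by (auto simp: linked_iff)
    then have "w x \<simeq> w y" using const zy by (metis rtranclp_trans)
    then show "w z \<simeq> w y" using linked_weight[OF z] simeq_sym simeq_trans by blast
  qed
qed

lemma finite_essential_imp_recurrent:
  assumes ess: "essential_component V U b C" and fin: "finite C"
    and stay: "\<forall>x\<in>C. \<forall>y\<in>V - U. \<pi> x y = 0" and x: "x \<in> C"
  shows "recurrent V U b x"
proof -
  have comp: "strong_component V U b C" and const: "\<And>y z. y \<in> C \<Longrightarrow> step\<^sup>*\<^sup>* y z \<Longrightarrow> w y \<simeq> w z"
    using ess by (auto simp: essential_component_iff)
  have CU: "C \<subseteq> U" "C \<subseteq> V" using comp U by (auto simp: strong_component_def strongly_connected_def)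
  have closed: "z \<in> C" if y: "y \<in> C" and z: "z \<in> V" and P: "\<pi> y z \<noteq> 0" for y z
  proof -
    have zU: "z \<in> U" using stay y z P by blast
    have "0 < \<pi> y z" using P real_trans_nonneg[of y z] CU y z by force
    then have yz: "b y z \<simeq> w y" using real_trans_pos_iff y z CU by blast
    \<comment> \<open>Essentiality keeps the target in the weight class of \<open>y\<close>, so this
      single edge already links \<open>z\<close> to \<open>y\<close>.\<close>
    then have "w y \<simeq> w z" using const[OF y, of z] zU by (simp add: step_def r_into_rtranclp)
    moreover have "link y y z" using zU simeq_sym[OF yz] by (simp add: link_def)
    ultimately have "linked y z" using y CU by (auto simp: linked_iff)
    then show ?thesis using strong_component_eq_linked[OF comp y] by blast
  qed
  have stoch: "(\<Sum>z\<in>C. \<pi> y z) = 1" if y: "y \<in> C" for y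
  proof -
    \<comment> \<open>The row of \<open>y\<close> is supported in both \<open>C\<close> and the
      neighbors, so the two sums agree although neither set need contain the other.\<close>
    have "(\<Sum>z\<in>C. \<pi> y z) = (\<Sum>z\<in>neighbors V b y. \<pi> y z)"
      using y CU fin finite_neighbors[of y] closed[OF y] real_trans_not_neighbor[of y]
      by (intro sum.mono_neutral_cong) (auto simp: neighbors_def)
    then show ?thesis using sum_real_trans y CU by auto
  qed
  have reach: "(\<lambda>u v. v \<in> C \<and> 0 < \<pi> u v)\<^sup>*\<^sup>* y x" if y: "y \<in> C" for y
  proof -
    have "linked y x" using strong_component_eq_linked[OF comp y] x by blast
    then have "step\<^sup>*\<^sup>* y x"
      using links_imp_steps[OF _ const[OF y]] y CU by (auto simp: linked_iff)
    then have "x \<in> C \<and> (\<lambda>u v. v \<in> C \<and> 0 < \<pi> u v)\<^sup>*\<^sup>* y x"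
    proof (induction rule: rtranclp_induct)
      case (step u v)
      have "v \<in> V" using step(2) U by (auto simp: step_def)
      then have "0 < \<pi> u v"
        using step real_trans_pos_iff[of u v] CU by (auto simp: step_def)
      then have "v \<in> C \<and> 0 < \<pi> u v" using closed[of u v] step.IH \<open>v \<in> V\<close> by auto
      then show ?case using step.IH by (auto intro: rtranclp.rtrancl_into_rtrancl)
    qed (use y in simp)
    then show ?thesis ..
  qed
  have "\<P>(\<omega> in M. \<exists>\<^sub>\<infinity>n. X n \<omega> = x) = 1" if "markov_chain M X V \<pi> x"
    for M :: "(nat \<Rightarrow> 'v) measure" and X
    by (rule finite_irreducible_infinitely_often[OF that V(1) fin x CU(2) _ stoch closed reach])
      (use real_trans_nonneg CU in auto)
  then show ?thesis using x CU by (auto simp: recurrent_def)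
qed

end

theorem theorem3p15:
  fixes V U :: "'v set" and b :: "'v \<Rightarrow> 'v \<Rightarrow> 'k::linordered_field"
  assumes "countable V"
    and "\<nexists>x. V = {x}"
    and "weighted_graph V b"
    and "connected_graph V b"
    and "locally_finite_graph V b"
    and "U \<subseteq> V"
  shows
    "(\<forall>x\<in>U. recurrent V U b x \<longrightarrow> (\<exists>C. essential_component V U b C \<and> x \<in> C)) \<and>
     (\<forall>C. essential_component V U b C \<and> finite C \<and>
          (\<forall>x\<in>C. \<forall>y\<in>V - U. real_trans V U b x y = 0) \<longrightarrow>
        (\<forall>x\<in>C. recurrent V U b x)) \<and>
     (\<forall>x\<in>U. \<not> (\<exists>C. essential_component V U b C \<and> x \<in> C) \<longrightarrow> transient V U b x)"
proof -
  interpret network V U b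
    using assms by unfold_locales
  show ?thesis
  proof (intro conjI allI ballI impI)
    fix x assume "recurrent V U b x"
    then show "\<exists>C. essential_component V U b C \<and> x \<in> C" by (rule recurrent_imp_essential)
  next
    fix C x
    assume "essential_component V U b C \<and> finite C \<and> (\<forall>x\<in>C. \<forall>y\<in>V - U. \<pi> x y = 0)" "x \<in> C"
    then show "recurrent V U b x" using finite_essential_imp_recurrent by blast
  next
    fix x assume "x \<in> U" "\<nexists>C. essential_component V U b C \<and> x \<in> C"
    \<comment> \<open>Transience is the negation of recurrence within \<open>U\<close>, so this is
      the contrapositive of the first claim.\<close>
    then show "transient V U b x" using recurrent_imp_essential[of x] by (auto simp: transient_def)
  qed
qed

end
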